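(* In the one-sided unbounded forecasting game, by the Bayesian strategy with any prior density $\pi$ satisfying the regularity conditions stated in the context, Skeptic weakly forces the event $$A_\infty=\infty\ \Longrightarrow\ \limsup_n\frac{S_n}{A_n^2}\le0 .$$
   Context: One-sided unbounded forecasting game (OUFG). Skeptic starts with an initial capital $\mathcal K_0>0$. On each round $n=1,2,\dots$, Skeptic announces $M_n\in\mathbb R$, then Reality announces $x_n\in[-1,\infty)$, and $\mathcal K_n=\mathcal K_{n-1}+M_nx_n$. Skeptic must keep $\mathcal K_n\ge 0$ for all $n$ whatever Reality does. A path is an infinite sequence $(x_n)_{n\ge1}$ in $[-1,\infty)$; an event is a set of paths. A strategy of Skeptic ($M_n$ as a function of $x_1,\dots,x_{n-1}$, keeping the capital nonnegative on every path) weakly forces an event $E$ if $\limsup_n\mathcal K_n=\infty$ on every path not in $E$. The event "$P\Rightarrow Q$" is the set of paths for which $P$ fails or $Q$ holds. Notation: $S_n=x_1+\dots+x_n$, $A_n^2=x_1^2+\dots+x_n^2$ with $A_n\ge0$, $A_\infty=\lim_nA_n$. The Bayesian strategy with prior density $\pi$ bets $M_n=\epsilon_n\mathcal K_{n-1}$ where $$\epsilon_n=\frac{\int_0^1\epsilon\prod_{i=1}^{n-1}(1+\epsilon x_i)\pi(\epsilon)\,d\epsilon}{\int_0^1\prod_{i=1}^{n-1}(1+\epsilon x_i)\pi(\epsilon)\,d\epsilon},$$ with initial capital $\int_0^1\pi(\epsilon)d\epsilon$; its capital process is $\mathcal K_n^\pi=\int_0^1\prod_{i=1}^n(1+\epsilon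 x_i)\pi(\epsilon)\,d\epsilon$. Regularity conditions on $\pi$: there exist $\epsilon_\pi\in(0,1)$ and $\delta_\pi>0$ such that (1) $\pi$ is nonnegative and integrable on $[0,1]$ (its integral need not be $1$); (2) $\pi(\epsilon)\ge\delta_\pi$ on $(0,\epsilon_\pi)$; (3) $\epsilon\pi(\epsilon)$ is increasing (i.e. nondecreasing) on $(0,\epsilon_\pi)$. *)

theory Defs
  imports "HOL-Analysis.Analysis"
begin

text \<open>
  Sequences are indexed from 0: for a path \<open>x\<close>, the number \<open>x n\<close> is Reality's move in round
  \<open>n + 1\<close>. A strategy maps the list of Reality's past moves, oldest first, to Skeptic's next bet.
\<close>

type_synonym strategy = "real list \<Rightarrow> real"

definition paths :: "(nat \<Rightarrow> real) set" where
  "paths = {x. \<forall>n. -1 \<le> x n}"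

definition history :: "(nat \<Rightarrow> real) \<Rightarrow> nat \<Rightarrow> real list" where
  "history x n = map x [0..<n]"

text \<open>The capital after the moves \<open>xs\<close>; its round-by-round form is \<open>capital_snoc\<close> below.\<close>

definition capital :: "real \<Rightarrow> strategy \<Rightarrow> real list \<Rightarrow> real" where
  "capital K0 M xs = K0 + (\<Sum>i<length xs. M (take i xs) * xs ! i)"

lemma capital_Nil: "capital K0 M [] = K0"
  by (simp add: capital_def)

lemma capital_snoc: "capital K0 M (xs @ [x]) = capital K0 M xs + M xs * x"
proof -
  have "(\<Sum>i<length xs. M (take i (xs @ [x])) * (xs @ [x]) ! i)
      = (\<Sum>i<length xs. M (take i xs) * xs ! i)"
    by (intro sum.cong) (auto simp: nth_append)
  then show ?thesis
    by (simp add: capital_def)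
qed

lemma capital_history_Suc:
  "capital K0 M (history x (Suc n)) = capital K0 M (history x n) + M (history x n) * x n"
  by (simp add: history_def capital_snoc)

definition weakly_forces :: "real \<Rightarrow> strategy \<Rightarrow> (nat \<Rightarrow> real) set \<Rightarrow> bool" where
  "weakly_forces K0 M E \<longleftrightarrow>
     0 < K0 \<and>
     (\<forall>x\<in>paths. \<forall>n. 0 \<le> capital K0 M (history x n)) \<and>
     (\<forall>x\<in>paths - E. limsup (\<lambda>n. ereal (capital K0 M (history x n))) = \<infinity>)"

definition S :: "(nat \<Rightarrow> real) \<Rightarrow> nat \<Rightarrow> real" where
  "S x n = (\<Sum>i<n. x i)"

definition A :: "(nat \<Rightarrow> real) \<Rightarrow> nat \<Rightarrow> real" where
  "A x n = sqrt (\<Sum>i<n. (x i)\<^sup>2)"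

definition A_inf :: "(nat \<Rightarrow> real) \<Rightarrow> ereal" where
  "A_inf x = lim (\<lambda>n. ereal (A x n))"

definition regular_prior :: "(real \<Rightarrow> real) \<Rightarrow> bool" where
  "regular_prior \<pi> \<longleftrightarrow>
     (\<exists>\<epsilon>\<^sub>\<pi> \<delta>\<^sub>\<pi>. 0 < \<epsilon>\<^sub>\<pi> \<and> \<epsilon>\<^sub>\<pi> < 1 \<and> 0 < \<delta>\<^sub>\<pi> \<and>
        (\<forall>\<epsilon>\<in>{0..1}. 0 \<le> \<pi> \<epsilon>) \<and> set_integrable lebesgue {0..1} \<pi> \<and>
        (\<forall>\<epsilon>\<in>{0<..<\<epsilon>\<^sub>\<pi>}. \<delta>\<^sub>\<pi> \<le> \<pi> \<epsilon>) \<and>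
        mono_on {0<..<\<epsilon>\<^sub>\<pi>} (\<lambda>\<epsilon>. \<epsilon> * \<pi> \<epsilon>))"

definition bayes_initial :: "(real \<Rightarrow> real) \<Rightarrow> real" where
  "bayes_initial \<pi> = (LINT \<epsilon>:{0..1}|lebesgue. \<pi> \<epsilon>)"

definition bayes_fraction :: "(real \<Rightarrow> real) \<Rightarrow> real list \<Rightarrow> real" where
  "bayes_fraction \<pi> xs =
     (LINT \<epsilon>:{0..1}|lebesgue. \<epsilon> * (\<Prod>x\<leftarrow>xs. 1 + \<epsilon> * x) * \<pi> \<epsilon>) /
     (LINT \<epsilon>:{0..1}|lebesgue. (\<Prod>x\<leftarrow>xs. 1 + \<epsilon> * x) * \<pi> \<epsilon>)"

text \<open>
  The second factor is the strategy's own current capital (\<open>bayes_strategy_eq\<close>), unfolded so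
  that the recursion is visibly on shorter histories.
\<close>

function bayes_strategy :: "(real \<Rightarrow> real) \<Rightarrow> strategy" where
  "bayes_strategy \<pi> xs = bayes_fraction \<pi> xs *
     (bayes_initial \<pi> + (\<Sum>i<length xs. bayes_strategy \<pi> (take i xs) * xs ! i))"
  by pat_completeness auto
termination
  by (relation "Wellfounded.measure (\<lambda>(\<pi>, xs). length xs)") auto

declare bayes_strategy.simps [simp del]

lemma bayes_strategy_eq:
  "bayes_strategy \<pi> xs = bayes_fraction \<pi> xs * capital (bayes_initial \<pi>) (bayes_strategy \<pi>) xs"
  unfolding capital_def by (rule bayes_strategy.simps)

end

theory Submission imports Defs begin

text \<open>
  By \<open>t - 2 * t\<^sup>2 \<le> ln (1 + t)\<close> for \<open>t \<ge> -1/2\<close>, the constant-proportion bet \<open>\<epsilon>\<close> has capital at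
  least \<open>exp (\<epsilon> * S - 2 * \<epsilon>\<^sup>2 * A\<^sup>2)\<close>. Whenever \<open>S \<ge> c * A\<^sup>2\<close>, this is at least
  \<open>exp (c\<^sup>2 * A\<^sup>2 / 16)\<close> for all \<open>\<epsilon>\<close> in \<open>[c/8, c/4]\<close>, an interval to which the prior assigns
  positive mass; so the mixture is unbounded when this happens along a sequence with \<open>A \<rightarrow> \<infinity>\<close>.
\<close>

lemma exp_diff_square_le:
  fixes t :: real
  assumes "-1/2 \<le> t"
  shows "exp (t - 2 * t\<^sup>2) \<le> 1 + t"
proof (cases "t \<le> 1/2")
  case True
  then have "\<bar>ln (1 + t) - t\<bar> \<le> 2 * t\<^sup>2"
    using assms by (intro abs_ln_one_plus_x_minus_x_bound) auto
  then have "t - 2 * t\<^sup>2 \<le> ln (1 + t)"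
    by linarith
  then have "exp (t - 2 * t\<^sup>2) \<le> exp (ln (1 + t))"
    by simp
  then show ?thesis
    using assms by simp
next
  \<comment> \<open>The logarithmic estimate used above covers only
    \<open>\<bar>t\<bar> \<le> 1/2\<close>. For larger \<open>t\<close> the exponent is at most 0,
    so the left side is at most 1.\<close>
  case False
  then have "t * 1 \<le> t * (2 * t)"
    by (intro mult_left_mono) auto
  then have "t - 2 * t\<^sup>2 \<le> 0"
    by (simp add: power2_eq_square)
  then have "exp (t - 2 * t\<^sup>2) \<le> 1"
    by simp
  then show ?thesis
    using False by linarith
qed

text \<open>A continuous factor is bounded and measurable on a compact interval. This makes the
  mixture integrands integrable, although the prior itself may be unbounded.\<close>

lemma set_integrable_continuous_mult:
  fixes f g :: "real \<Rightarrow> real"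
  assumes "continuous_on {a..b} f" and "set_integrable lebesgue {a..b} g"
  shows "set_integrable lebesgue {a..b} (\<lambda>x. f x * g x)"
proof (rule absolutely_integrable_bounded_measurable_product_real)
  show "f \<in> borel_measurable (lebesgue_on {a..b})"
    using assms(1) by (intro continuous_imp_measurable_on_sets_lebesgue) auto
  show "bounded (f ` {a..b})"
    using assms(1) by (intro compact_imp_bounded compact_continuous_image) auto
qed (use assms in auto)

lemma set_integral_ge_const:
  fixes f :: "real \<Rightarrow> real"
  assumes "set_integrable lebesgue X f" and "\<And>x. x \<in> X \<Longrightarrow> 0 \<le> f x"
    and "{a..b} \<subseteq> X" and "a \<le> b" and "\<And>x. x \<in> {a..b} \<Longrightarrow> m \<le> f x"
  shows "(b - a) * m \<le> (LINT x:X|lebesgue. f x)"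
proof -
  have int: "set_integrable lebesgue {a..b} f"
    by (rule set_integrable_subset[OF assms(1) _ assms(3)]) simp
  have "(b - a) * m = (LINT x:{a..b}|lebesgue. m)"
    using assms(4) by (simp add: set_lebesgue_integral_def)
  also have "\<dots> \<le> (LINT x:{a..b}|lebesgue. f x)"
    using int assms(5) by (intro set_integral_mono absolutely_integrable_on_const) auto
  also have "\<dots> \<le> (LINT x:X|lebesgue. f x)"
    \<comment> \<open>Outside \<open>{a..b}\<close> the smaller integrand is 0, while
      \<open>f\<close> is nonnegative on the rest of \<open>X\<close>.\<close>
    unfolding set_lebesgue_integral_def
    using int assms(1-3) unfolding set_integrable_def
    by (intro integral_mono) (auto simp: indicator_def)
  finally show ?thesis .
qed

section \<open>Capital of a constant-proportion bet\<close>

abbreviation bet_capital :: "real \<Rightarrow> real list \<Rightarrow> real" where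
  "bet_capital \<epsilon> xs \<equiv> (\<Prod>x\<leftarrow>xs. 1 + \<epsilon> * x)"

text \<open>The closed form of the Bayesian capital process, and also the denominator of
  \<open>bayes_fraction\<close>.\<close>

definition mixture :: "(real \<Rightarrow> real) \<Rightarrow> real list \<Rightarrow> real" where
  "mixture \<pi> xs = (LINT \<epsilon>:{0..1}|lebesgue. bet_capital \<epsilon> xs * \<pi> \<epsilon>)"

lemma continuous_on_bet_capital: "continuous_on I (\<lambda>\<epsilon>. bet_capital \<epsilon> xs)"
  by (induction xs) (auto intro!: continuous_intros)

text \<open>Every move is at least -1, so each factor is at least
  \<open>1 - \<epsilon>\<close>.\<close>

lemma bet_capital_ge_power:
  assumes "set xs \<subseteq> {-1..}" "0 \<le> \<epsilon>" "\<epsilon> \<le> 1"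
  shows "(1 - \<epsilon>) ^ length xs \<le> bet_capital \<epsilon> xs"
  using assms(1)
proof (induction xs)
  case (Cons x xs)
  have "\<epsilon> * (-1) \<le> \<epsilon> * x"
    using Cons.prems assms(2) by (intro mult_left_mono) auto
  then show ?case
    using Cons assms by (auto intro!: mult_mono)
qed simp

lemma bet_capital_nonneg:
  assumes "set xs \<subseteq> {-1..}" "0 \<le> \<epsilon>" "\<epsilon> \<le> 1"
  shows "0 \<le> bet_capital \<epsilon> xs"
  using bet_capital_ge_power[OF assms] assms(3) by (smt (verit) zero_le_power)

text \<open>The bound \<open>exp_diff_square_le\<close> is applied factor by factor with
  \<open>t = \<epsilon> * x\<close>; the restriction to \<open>\<epsilon> \<le> 1/2\<close> ensures
  \<open>t \<ge> -1/2\<close>.\<close>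

lemma bet_capital_ge_exp:
  assumes "set xs \<subseteq> {-1..}" "0 \<le> \<epsilon>" "\<epsilon> \<le> 1/2"
  shows "exp (\<epsilon> * (\<Sum>x\<leftarrow>xs. x) - 2 * \<epsilon>\<^sup>2 * (\<Sum>x\<leftarrow>xs. x\<^sup>2)) \<le> bet_capital \<epsilon> xs"
  using assms(1)
proof (induction xs)
  case (Cons x xs)
  have "\<epsilon> * (-1) \<le> \<epsilon> * x"
    using Cons.prems assms(2) by (intro mult_left_mono) auto
  then have x: "-1/2 \<le> \<epsilon> * x"
    using assms(3) by linarith
  have "exp (\<epsilon> * (\<Sum>x\<leftarrow>x # xs. x) - 2 * \<epsilon>\<^sup>2 * (\<Sum>x\<leftarrow>x # xs. x\<^sup>2)) =
      exp (\<epsilon> * x - 2 * (\<epsilon> * x)\<^sup>2) * exp (\<epsilon> * (\<Sum>x\<leftarrow>xs. x) - 2 * \<epsilon>\<^sup>2 * (\<Sum>x\<leftarrow>xs. x\<^sup>2))"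
    by (simp add: exp_add[symmetric] algebra_simps power_mult_distrib)
  also have "\<dots> \<le> (1 + \<epsilon> * x) * bet_capital \<epsilon> xs"
    using Cons exp_diff_square_le[OF x] x by (intro mult_mono) auto
  finally show ?case
    by simp
qed simp

section \<open>The mixture of bets under the prior\<close>

locale prior_positive_near_0 =
  fixes \<pi> :: "real \<Rightarrow> real" and r d :: real
  assumes r: "0 < r" "r < 1" and d: "0 < d"
    and prior_nonneg: "\<And>\<epsilon>. \<epsilon> \<in> {0..1} \<Longrightarrow> 0 \<le> \<pi> \<epsilon>"
    and prior_integrable: "set_integrable lebesgue {0..1} \<pi>"
    and prior_ge: "\<And>\<epsilon>. \<epsilon> \<in> {0<..<r} \<Longrightarrow> d \<le> \<pi> \<epsilon>"
begin

lemma mixture_ge: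
  assumes "set xs \<subseteq> {-1..}" "0 < a" "a \<le> b" "b < r" "0 \<le> m"
    and "\<And>\<epsilon>. \<epsilon> \<in> {a..b} \<Longrightarrow> m \<le> bet_capital \<epsilon> xs"
  shows "(b - a) * (m * d) \<le> mixture \<pi> xs"
  unfolding mixture_def
proof (rule set_integral_ge_const)
  show "set_integrable lebesgue {0..1} (\<lambda>\<epsilon>. bet_capital \<epsilon> xs * \<pi> \<epsilon>)"
    by (intro set_integrable_continuous_mult continuous_on_bet_capital prior_integrable)
  show "0 \<le> bet_capital \<epsilon> xs * \<pi> \<epsilon>" if "\<epsilon> \<in> {0..1}" for \<epsilon>
    using that assms(1) by (intro mult_nonneg_nonneg bet_capital_nonneg prior_nonneg) auto
  show "m * d \<le> bet_capital \<epsilon> xs * \<pi> \<epsilon>" if "\<epsilon> \<in> {a..b}" for \<epsilon>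
  proof (rule mult_mono)
    show "m \<le> bet_capital \<epsilon> xs" "d \<le> \<pi> \<epsilon>"
      using that assms prior_ge by auto
    then show "0 \<le> bet_capital \<epsilon> xs" "0 \<le> d"
      using assms(5) d by linarith+
  qed
qed (use assms r in auto)

text \<open>Serves twice: the denominator of \<open>bayes_fraction\<close> never vanishes, and
  Skeptic's capital stays nonnegative.\<close>

lemma mixture_pos:
  assumes "set xs \<subseteq> {-1..}"
  shows "0 < mixture \<pi> xs"
proof -
  \<comment> \<open>The interval \<open>{r/4..r/2}\<close> has positive length inside
    \<open>(0, r)\<close> and stays away from 1, so that the power bound is uniformly positive
    there.\<close>
  have "(1 - r/2) ^ length xs \<le> bet_capital \<epsilon> xs" if "\<epsilon> \<in> {r/4..r/2}" for \<epsilon>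
  proof -
    have "(1 - r/2) ^ length xs \<le> (1 - \<epsilon>) ^ length xs"
      using that r by (intro power_mono) auto
    also have "\<dots> \<le> bet_capital \<epsilon> xs"
      using that r assms by (intro bet_capital_ge_power) auto
    finally show ?thesis .
  qed
  then have "(r/2 - r/4) * ((1 - r/2) ^ length xs * d) \<le> mixture \<pi> xs"
    using r assms by (intro mixture_ge) auto
  moreover have "0 < (r/2 - r/4) * ((1 - r/2) ^ length xs * d)"
    using r d by simp
  ultimately show ?thesis
    by linarith
qed

text \<open>The new factor \<open>1 + \<epsilon> * x\<close> splits the integral into a part
  constant in \<open>x\<close> and a part linear in \<open>x\<close>, whose slope is the numerator
  of \<open>bayes_fraction\<close>.\<close>

lemma mixture_snoc:
  "mixture \<pi> (xs @ [x]) =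
    mixture \<pi> xs + (LINT \<epsilon>:{0..1}|lebesgue. \<epsilon> * bet_capital \<epsilon> xs * \<pi> \<epsilon>) * x"
proof -
  have "mixture \<pi> (xs @ [x]) =
      (LINT \<epsilon>:{0..1}|lebesgue. bet_capital \<epsilon> xs * \<pi> \<epsilon> + (\<epsilon> * bet_capital \<epsilon> xs * \<pi> \<epsilon>) * x)"
    unfolding mixture_def by (simp add: algebra_simps)
  also have "\<dots> = mixture \<pi> xs + (LINT \<epsilon>:{0..1}|lebesgue. (\<epsilon> * bet_capital \<epsilon> xs * \<pi> \<epsilon>) * x)"
    unfolding mixture_def
    by (intro set_integral_add set_integrable_mult_left set_integrable_continuous_mult
        continuous_on_mult continuous_on_id continuous_on_bet_capital prior_integrable)
  finally show ?thesis
    by simp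
qed

lemma capital_bayes_strategy:
  assumes "set xs \<subseteq> {-1..}"
  shows "capital (bayes_initial \<pi>) (bayes_strategy \<pi>) xs = mixture \<pi> xs"
  using assms
proof (induction xs rule: rev_induct)
  case Nil
  then show ?case
    by (simp add: capital_Nil bayes_initial_def mixture_def)
next
  case (snoc x xs)
  then have "capital (bayes_initial \<pi>) (bayes_strategy \<pi>) (xs @ [x]) =
      mixture \<pi> xs + bayes_fraction \<pi> xs * mixture \<pi> xs * x"
    by (simp add: capital_snoc bayes_strategy_eq[of \<pi> xs])
  also have "bayes_fraction \<pi> xs * mixture \<pi> xs =
      (LINT \<epsilon>:{0..1}|lebesgue. \<epsilon> * bet_capital \<epsilon> xs * \<pi> \<epsilon>)"
    using mixture_pos[of xs] snoc.prems by (simp add: bayes_fraction_def mixture_def)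
  finally show ?case
    by (simp add: mixture_snoc)
qed

text \<open>The bounds \<open>c \<le> 2\<close> and \<open>c \<le> r\<close> place
  \<open>{c/8..c/4}\<close> inside \<open>(0, 1/2]\<close>, where the exponential bound holds, and
  inside \<open>(0, r)\<close>, where the prior is at least \<open>d\<close>.\<close>

lemma mixture_ge_exp:
  assumes "set xs \<subseteq> {-1..}" "0 < c" "c \<le> 2" "c \<le> r"
    and "c * (\<Sum>x\<leftarrow>xs. x\<^sup>2) \<le> (\<Sum>x\<leftarrow>xs. x)"
  shows "c / 8 * (exp (c\<^sup>2 / 16 * (\<Sum>x\<leftarrow>xs. x\<^sup>2)) * d) \<le> mixture \<pi> xs"
proof -
  define Q where "Q = (\<Sum>x\<leftarrow>xs. x\<^sup>2)"
  have Q: "0 \<le> Q"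
    unfolding Q_def by (intro sum_list_nonneg) auto
  have "exp (c\<^sup>2 / 16 * Q) \<le> bet_capital \<epsilon> xs" if \<epsilon>: "\<epsilon> \<in> {c/8..c/4}" for \<epsilon>
  proof -
    have "c\<^sup>2 / 16 * Q = (c/8) * (c/2) * Q"
      by (simp add: power2_eq_square)
    \<comment> \<open>On this interval \<open>\<epsilon> \<ge> c/8\<close>, and
      \<open>\<epsilon> \<le> c/4\<close> gives \<open>c - 2 * \<epsilon> \<ge> c/2\<close>.\<close>
    also have "\<dots> \<le> \<epsilon> * (c - 2 * \<epsilon>) * Q"
      using \<epsilon> assms(2) Q by (intro mult_right_mono mult_mono) auto
    also have "\<dots> = \<epsilon> * (c * Q) - 2 * \<epsilon>\<^sup>2 * Q"
      by (simp add: algebra_simps power2_eq_square)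
    also have "\<dots> \<le> \<epsilon> * (\<Sum>x\<leftarrow>xs. x) - 2 * \<epsilon>\<^sup>2 * Q"
      using \<epsilon> assms(2,5) unfolding Q_def by (intro diff_right_mono mult_left_mono) auto
    finally have "exp (c\<^sup>2 / 16 * Q) \<le> exp (\<epsilon> * (\<Sum>x\<leftarrow>xs. x) - 2 * \<epsilon>\<^sup>2 * Q)"
      by simp
    also have "\<dots> \<le> bet_capital \<epsilon> xs"
      unfolding Q_def using \<epsilon> assms by (intro bet_capital_ge_exp) auto
    finally show ?thesis .
  qed
  then have "(c/4 - c/8) * (exp (c\<^sup>2 / 16 * Q) * d) \<le> mixture \<pi> xs"
    using assms by (intro mixture_ge) auto
  then show ?thesis
    unfolding Q_def by simp
qed

end

section \<open>Histories of paths and growth of \<open>A\<close>\<close>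

lemma set_history_subset: "x \<in> paths \<Longrightarrow> set (history x n) \<subseteq> {-1..}"
  by (auto simp: paths_def history_def)

lemma sum_list_history: "(\<Sum>y\<leftarrow>history x n. f y) = (\<Sum>i<n. f (x i))"
  by (simp add: history_def comp_def interv_sum_list_conv_sum_set_nat atLeast0LessThan)

lemma A_squared: "(A x n)\<^sup>2 = (\<Sum>i<n. (x i)\<^sup>2)"
  by (simp add: A_def sum_nonneg)

lemma mono_A: "mono (A x)"
  unfolding A_def by (intro monoI real_sqrt_le_mono sum_mono2) auto

text \<open>Monotonicity guarantees that the limit in \<open>A_inf\<close> exists, so its value
  determines the actual behavior of \<open>A\<close>.\<close>

lemma filterlim_A_at_top:
  assumes "A_inf x = \<infinity>"
  shows "filterlim (A x) at_top sequentially"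
proof -
  have "mono (\<lambda>n. ereal (A x n))"
    using mono_A[of x] by (auto simp: mono_def)
  then have "(\<lambda>n. ereal (A x n)) \<longlonglongrightarrow> (SUP n. ereal (A x n))"
    by (rule LIMSEQ_SUP)
  then have "(\<lambda>n. ereal (A x n)) \<longlonglongrightarrow> \<infinity>"
    using assms limI unfolding A_inf_def by metis
  then show ?thesis
    by (simp add: tendsto_PInfty_eq_at_top)
qed

theorem proposition3p1:
  fixes \<pi> :: "real \<Rightarrow> real"
  assumes "regular_prior \<pi>"
  shows "weakly_forces (bayes_initial \<pi>) (bayes_strategy \<pi>)
    {x \<in> paths. A_inf x = \<infinity> \<longrightarrow> limsup (\<lambda>n. ereal (S x n / (A x n)\<^sup>2)) \<le> 0}"
proof -
  obtain r d where "prior_positive_near_0 \<pi> r d"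
    using assms unfolding regular_prior_def prior_positive_near_0_def by blast
  then interpret prior_positive_near_0 \<pi> r d .
  have capital: "capital (bayes_initial \<pi>) (bayes_strategy \<pi>) (history x n) = mixture \<pi> (history x n)"
    if "x \<in> paths" for x n
    using that by (intro capital_bayes_strategy set_history_subset)
  have "limsup (\<lambda>n. ereal (mixture \<pi> (history x n))) = \<infinity>"
    if x: "x \<in> paths" and A_inf: "A_inf x = \<infinity>"
      and pos: "\<not> limsup (\<lambda>n. ereal (S x n / (A x n)\<^sup>2)) \<le> 0" for x
  proof -
    have "0 < limsup (\<lambda>n. ereal (S x n / (A x n)\<^sup>2))"
      using pos by (simp only: not_le)
    \<comment> \<open>The upper limit may be infinite, so a real threshold strictly below it is
      chosen.\<close>
    from ereal_dense2[OF this] obtain b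
      where "0 < ereal b" and gt: "ereal b < limsup (\<lambda>n. ereal (S x n / (A x n)\<^sup>2))"
      by (elim exE conjE)
    then have b: "0 < b"
      by simp
    have frequently_gt: "\<exists>\<^sub>F n in sequentially. b < S x n / (A x n)\<^sup>2"
    proof (rule ccontr)
      assume "\<not> ?thesis"
      then have "\<forall>\<^sub>F n in sequentially. ereal (S x n / (A x n)\<^sup>2) \<le> ereal b"
        by (simp only: not_frequently not_less ereal_less_eq)
      from Limsup_bounded[OF this] gt show False
        by (rule leD[THEN notE])
    qed
    \<comment> \<open>Lowering the threshold to at most \<open>r\<close> keeps the betting interval
      where the prior is bounded below; \<open>r < 1\<close> also gives
      \<open>c \<le> 2\<close>.\<close>
    define c where "c = min b r"
    have c: "0 < c" "c \<le> b" "c \<le> r"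
      using b r by (auto simp: c_def)
    define g where "g = (\<lambda>n. c / 8 * (exp (c\<^sup>2 / 16 * (A x n)\<^sup>2) * d))"
    have frequent: "\<exists>\<^sub>F n in sequentially. g n \<le> mixture \<pi> (history x n)"
      using frequently_gt
    proof (rule frequently_elim1)
      fix n assume n: "b < S x n / (A x n)\<^sup>2"
      \<comment> \<open>Division by zero yields 0, which cannot exceed the positive
        \<open>b\<close>.\<close>
      then have "A x n \<noteq> 0"
        using b by auto
      then have "c * (A x n)\<^sup>2 \<le> S x n"
        using n c by (simp add: pos_less_divide_eq) (smt (verit) mult_right_mono zero_le_power2)
      then show "g n \<le> mixture \<pi> (history x n)"
        using mixture_ge_exp[OF set_history_subset[OF x] c(1) _ c(3), of n] c r
        unfolding g_def sum_list_history A_squared S_def by simp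
    qed
    have "filterlim (\<lambda>n. (A x n)\<^sup>2) at_top sequentially"
      by (intro filterlim_pow_at_top filterlim_A_at_top[OF A_inf]) simp
    then have "filterlim (\<lambda>n. c\<^sup>2 / 16 * (A x n)\<^sup>2) at_top sequentially"
      by (rule filterlim_tendsto_pos_mult_at_top[OF tendsto_const, rotated]) (use c in simp)
    then have "filterlim (\<lambda>n. exp (c\<^sup>2 / 16 * (A x n)\<^sup>2)) at_top sequentially"
      by (rule filterlim_compose[OF exp_at_top])
    then have "filterlim (\<lambda>n. (c / 8 * d) * exp (c\<^sup>2 / 16 * (A x n)\<^sup>2)) at_top sequentially"
      by (rule filterlim_tendsto_pos_mult_at_top[OF tendsto_const, rotated]) (use c d in simp)
    then have g: "filterlim g at_top sequentially"
      unfolding g_def by (simp add: mult_ac)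
    \<comment> \<open>The capital is at least \<open>g\<close> infinitely often and \<open>g\<close>
      tends to infinity. An upper limit below \<open>M\<close> would put the capital eventually
      below \<open>M\<close>, hence below \<open>g\<close>.\<close>
    have "ereal M \<le> limsup (\<lambda>n. ereal (mixture \<pi> (history x n)))" for M
    proof (rule ccontr)
      assume "\<not> ?thesis"
      then have "\<forall>\<^sub>F n in sequentially. ereal (mixture \<pi> (history x n)) < ereal M"
        by (intro Limsup_lessD) auto
      moreover have "\<forall>\<^sub>F n in sequentially. M \<le> g n"
        using g by (simp add: filterlim_at_top)
      ultimately have "\<forall>\<^sub>F n in sequentially. \<not> g n \<le> mixture \<pi> (history x n)"
        by eventually_elim auto
      then show False
        using frequent by (simp add: frequently_def)
    qed
    then show ?thesis
      by (rule ereal_top)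
  qed
  moreover have "0 < mixture \<pi> xs" if "set xs \<subseteq> {-1..}" for xs
    using that by (rule mixture_pos)
  \<comment> \<open>The initial capital is the mixture over the empty history.\<close>
  moreover from this have "0 < bayes_initial \<pi>"
    using capital_bayes_strategy[of "[]"] by (simp add: capital_Nil)
  ultimately show ?thesis
    unfolding weakly_forces_def
    by (auto simp: capital set_history_subset intro: less_imp_le)
qed

end
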